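(* Let $G$ be a connected graph of order $n\ge 2$ with distances $d_{rt}=d_G(v_r,v_t)$, and for $1\le r\le n$ let $\mathcal{D}^S_r=\sum_{t=1,\,t\ne r}^{n}(2d_{rt}-1)$. Then $$\rho^S(G)\le \max_{1\le r\le n}\sum_{t=1,\,t\ne r}^{n}(2d_{rt}-1)\sqrt{\frac{\mathcal{D}^S_t}{\mathcal{D}^S_r}},$$ with equality if and only if $\mathcal{D}^S_1=\mathcal{D}^S_2=\cdots=\mathcal{D}^S_n$.
   Context: The distance Seidel matrix of a connected graph $G$ on $v_1,\dots,v_n$ is $\mathcal{D}^S(G)=J-I-2\mathcal{D}(G)$, where $\mathcal{D}(G)=(d_{rt})$ is the distance matrix and $J$ the all-ones matrix. The distance Seidel spectral radius $\rho^S(G)$ is $\max_i|\partial_i^S|$ over the eigenvalues $\partial_i^S$ of $\mathcal{D}^S(G)$; equivalently, it is the largest eigenvalue of the nonnegative irreducible matrix $-\mathcal{D}^S(G)$. *)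

theory Defs
  imports
    "Jordan_Normal_Form.Spectral_Radius"
    "Graph_Theory.Shortest_Path"
    "Graph_Theory.Digraph_Component"
begin

(* Finite simple graphs are Digraph.graph: finite, loopless, symmetric digraphs without parallel
   arcs. With unit weights, the cost of a walk is its number of arcs. The ereal value is infinite
   only if there is no walk from u to v, which real_of_ereal would map to 0; on vertices of a
   connected graph this does not occur. *)
definition gdist :: "('a, 'b) pre_digraph \<Rightarrow> 'a \<Rightarrow> 'a \<Rightarrow> real" where
  "gdist G u w = real_of_ereal (wf_digraph.\<mu> G (\<lambda>_. 1) u w)"

(* In the following, v enumerates the n vertices as v 0, ..., v (n - 1), in accordance with the
   0-based matrix indices. *)
definition dist_mat :: "('a, 'b) pre_digraph \<Rightarrow> (nat \<Rightarrow> 'a) \<Rightarrow> nat \<Rightarrow> real mat" where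
  "dist_mat G v n = mat n n (\<lambda>(r, t). gdist G (v r) (v t))"

definition all_ones_mat :: "nat \<Rightarrow> real mat" where
  "all_ones_mat n = mat n n (\<lambda>_. 1)"

definition dist_seidel_mat :: "('a, 'b) pre_digraph \<Rightarrow> (nat \<Rightarrow> 'a) \<Rightarrow> nat \<Rightarrow> real mat" where
  "dist_seidel_mat G v n = all_ones_mat n - 1\<^sub>m n - 2 \<cdot>\<^sub>m dist_mat G v n"

(* The library's spectral_radius is the maximal modulus of the eigenvalues of a complex matrix.
   As the distance Seidel matrix is real symmetric, these eigenvalues are its real eigenvalues. *)
definition dist_seidel_radius :: "('a, 'b) pre_digraph \<Rightarrow> (nat \<Rightarrow> 'a) \<Rightarrow> nat \<Rightarrow> real" where
  "dist_seidel_radius G v n = spectral_radius (map_mat complex_of_real (dist_seidel_mat G v n))"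

definition dist_seidel_sum :: "('a, 'b) pre_digraph \<Rightarrow> (nat \<Rightarrow> 'a) \<Rightarrow> nat \<Rightarrow> nat \<Rightarrow> real" where
  "dist_seidel_sum G v n r = (\<Sum>t\<in>{0..<n} - {r}. 2 * gdist G (v r) (v t) - 1)"

definition dist_seidel_bound :: "('a, 'b) pre_digraph \<Rightarrow> (nat \<Rightarrow> 'a) \<Rightarrow> nat \<Rightarrow> real" where
  "dist_seidel_bound G v n =
     (MAX r\<in>{0..<n}. \<Sum>t\<in>{0..<n} - {r}.
        (2 * gdist G (v r) (v t) - 1) * sqrt (dist_seidel_sum G v n t / dist_seidel_sum G v n r))"

end

theory Submission
  imports Defs
begin

text \<open>
  The bound is the Collatz--Wielandt bound for \<open>-D\<^sup>S\<close>, taken at the positive vector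
  \<open>x\<^sub>r = sqrt D\<^sup>S\<^sub>r\<close>. As the off-diagonal entries are positive, equality forces \<open>x\<close> to be an
  eigenvector of \<open>-D\<^sup>S\<close> for the eigenvalue \<open>B\<close> given by the bound. If \<open>a\<close> and \<open>b\<close> are the least
  and the largest entry of \<open>x\<close>, then, since the row sums are \<open>x\<^sub>r\<^sup>2\<close>, the rows of \<open>a\<close> and \<open>b\<close> yield
  \<open>B \<le> a b\<close> and \<open>B \<ge> a b\<close>. Hence both are equalities: if \<open>a < b\<close>, then all entries but the one of
  \<open>a\<close> are \<open>b\<close> and all but the one of \<open>b\<close> are \<open>a\<close>, so \<open>n = 2\<close>, where symmetry makes the row sums
  equal.
\<close>

section \<open>Graph distances\<close>

lemma (in wf_digraph) awalk_cost_1: "awalk_cost (\<lambda>_. 1) p = real (length p)"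
  by (induct p) auto

text \<open>Induction along the walk: symmetry supplies an opposite arc for each arc, and these are
  appended in reverse order.\<close>

lemma (in sym_digraph) awalk_reverse:
  assumes "awalk u p w"
  obtains q where "awalk w q u" "length q = length p"
proof -
  have "\<exists>q. awalk w q u \<and> length q = length p"
    using assms
  proof (induct p arbitrary: u)
    case Nil
    then show ?case by (auto simp: awalk_Nil_iff)
  next
    case (Cons e es)
    then obtain q where q: "awalk w q (head G e)" "length q = length es"
      by (auto simp: awalk_Cons_iff)
    from Cons.prems have "e \<in> arcs G" "u = tail G e" by (auto simp: awalk_Cons_iff)
    then obtain e' where e': "e' \<in> arcs G" "tail G e' = head G e" "head G e' = u"
      using sym_arcs unfolding symmetric_conv by metis
    then have "awalk (head G e) [e'] u" using arc_implies_awalk by metis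
    with q show ?case by (intro exI[of _ "q @ [e']"]) (auto intro: awalk_appendI)
  qed
  with that show thesis by blast
qed

text \<open>Reversing walks preserves their length, so each of the two infima bounds the
  other.\<close>

lemma gdist_commute:
  assumes "Digraph.graph G"
  shows "gdist G u w = gdist G w u"
proof -
  interpret graph G by fact
  have le: "\<mu> (\<lambda>_. 1) y z \<le> \<mu> (\<lambda>_. 1) z y" for y z
    unfolding \<mu>_def
  proof (rule INF_mono)
    fix p assume "p \<in> {p. awalk z p y}"
    then have "awalk z p y" by simp
    then obtain q where "awalk y q z" "length q = length p" by (rule awalk_reverse)
    then show "\<exists>q\<in>{p. awalk y p z}. ereal (awalk_cost (\<lambda>_. 1) q) \<le> ereal (awalk_cost (\<lambda>_. 1) p)"
      by (auto simp: awalk_cost_1)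
  qed
  show ?thesis unfolding gdist_def by (simp add: antisym[OF le le])
qed

text \<open>Connectedness refers to the symmetric closure, which for a symmetric digraph has the
  same reachability. As unit costs are nonnegative, the infimum is then attained by a path; in
  particular it is finite.\<close>

lemma gdist_realized:
  assumes "Digraph.graph G" "Digraph_Component.connected G" "u \<in> verts G" "w \<in> verts G"
  obtains p where "pre_digraph.awalk G u p w" "gdist G u w = real (length p)"
proof -
  interpret graph G by fact
  have "u \<rightarrow>\<^sup>*\<^bsub>mk_symmetric G\<^esub> w"
    using assms(2-4) by (auto simp: connected_def strongly_connected_def)
  then have "u \<rightarrow>\<^sup>*\<^bsub>G\<^esub> w" by (simp only: reachable_mk_symmetric_eq[OF sym_arcs])
  then obtain p where "apath u p w" "\<mu> (\<lambda>_. 1) u w = awalk_cost (\<lambda>_. 1) p"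
    using min_cost_awalk[of u w "\<lambda>_. 1"] by auto
  with that show thesis by (auto simp: gdist_def awalk_cost_1 apath_def)
qed

lemma gdist_self:
  assumes "Digraph.graph G" "u \<in> verts G"
  shows "gdist G u u = 0"
proof -
  interpret graph G by fact
  have "\<mu> (\<lambda>_. 1) u u \<le> 0"
    using min_cost_le_walk_cost[of u "[]" u "\<lambda>_. 1"] assms(2)
    by (simp add: awalk_Nil_iff zero_ereal_def)
  moreover have "0 \<le> \<mu> (\<lambda>_. 1) u u"
    unfolding \<mu>_def by (rule INF_greatest) (simp add: awalk_cost_1)
  ultimately show ?thesis by (simp add: gdist_def)
qed

lemma gdist_ge_1:
  assumes "Digraph.graph G" "Digraph_Component.connected G" "u \<in> verts G" "w \<in> verts G" "u \<noteq> w"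
  shows "1 \<le> gdist G u w"
proof -
  interpret graph G by fact
  obtain p where "awalk u p w" and "gdist G u w = real (length p)"
    using gdist_realized assms by metis
  with assms(5) show ?thesis by (cases p) (auto simp: awalk_Nil_iff)
qed

section \<open>The Collatz--Wielandt bound\<close>

text \<open>Here \<open>c\<close> is the maximum of the ratios \<open>cmod (z $ t) / x t\<close> and
  \<open>r\<close> is an index attaining it. The last inequality is the triangle inequality applied
  to the rows of \<open>A z = k z\<close>.\<close>

lemma eigenvector_extremal_row:
  fixes A :: "complex mat" and x :: "nat \<Rightarrow> real"
  assumes A: "A \<in> carrier_mat n n" and x: "\<And>r. r < n \<Longrightarrow> 0 < x r"
    and ev: "eigenvector A z k"
  obtains r c where "r < n" "0 < c" "cmod (z $ r) = c * x r"
    "\<And>t. t < n \<Longrightarrow> cmod (z $ t) \<le> c * x t"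
    "\<And>t. t < n \<Longrightarrow> cmod k * cmod (z $ t) \<le> (\<Sum>s<n. cmod (A $$ (t, s)) * cmod (z $ s))"
proof -
  from ev A have z: "z \<in> carrier_vec n" "z \<noteq> 0\<^sub>v n" "A *\<^sub>v z = k \<cdot>\<^sub>v z"
    by (auto simp: eigenvector_def)
  then obtain i where i: "i < n" "z $ i \<noteq> 0"
    by (metis carrier_vecD eq_vecI index_zero_vec(1) index_zero_vec(2))
  define c where "c = Max ((\<lambda>t. cmod (z $ t) / x t) ` {..<n})"
  have "c \<in> (\<lambda>t. cmod (z $ t) / x t) ` {..<n}"
    unfolding c_def using i by (intro Max_in) auto
  then obtain r where r: "r < n" "c = cmod (z $ r) / x r" by auto
  have c: "cmod (z $ t) / x t \<le> c" if "t < n" for t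
    unfolding c_def using that by (intro Max_ge) auto
  have "0 < cmod (z $ i) / x i" using i x by simp
  with c[OF i(1)] have "0 < c" by linarith
  moreover have "cmod (z $ r) = c * x r" using r x[of r] by simp
  moreover have "cmod (z $ t) \<le> c * x t" if "t < n" for t
    using c[OF that] x[OF that] by (simp add: pos_divide_le_eq)
  moreover have "cmod k * cmod (z $ t) \<le> (\<Sum>s<n. cmod (A $$ (t, s)) * cmod (z $ s))"
    if "t < n" for t
  proof -
    have "k * z $ t = (A *\<^sub>v z) $ t" using that z by simp
    also have "\<dots> = (\<Sum>s<n. A $$ (t, s) * z $ s)"
      using that z(1) A by (auto simp: scalar_prod_def lessThan_atLeast0 intro!: sum.cong)
    finally have "cmod k * cmod (z $ t) = cmod (\<Sum>s<n. A $$ (t, s) * z $ s)"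
      by (simp flip: norm_mult)
    also have "\<dots> \<le> (\<Sum>s<n. cmod (A $$ (t, s)) * cmod (z $ s))"
      by (rule order_trans[OF norm_sum]) (simp add: norm_mult)
    finally show ?thesis .
  qed
  ultimately show thesis using that r(1) by blast
qed

text \<open>In the extremal row \<open>i\<close>, replacing each \<open>cmod (z $ s)\<close> by
  \<open>c * x s\<close> yields \<open>cmod k * c * x i \<le> B * c * x i\<close>. If this is tight,
  \<open>cmod (z $ s) = c * x s\<close> for all \<open>s\<close>, and then every row is
  tight.\<close>

lemma spectral_radius_le_weighted_row_sums:
  fixes A :: "complex mat" and x :: "nat \<Rightarrow> real"
  assumes A: "A \<in> carrier_mat n n" and n: "0 < n" and x: "\<And>r. r < n \<Longrightarrow> 0 < x r"
    and B: "\<And>r. r < n \<Longrightarrow> (\<Sum>t<n. cmod (A $$ (r, t)) * x t) \<le> B * x r"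
  shows "spectral_radius A \<le> B"
    and "\<lbrakk>spectral_radius A = B; \<And>r t. r < n \<Longrightarrow> t < n \<Longrightarrow> r \<noteq> t \<Longrightarrow> A $$ (r, t) \<noteq> 0; r < n\<rbrakk>
      \<Longrightarrow> (\<Sum>t<n. cmod (A $$ (r, t)) * x t) = B * x r"
proof -
  obtain k z where k: "spectral_radius A = cmod k" and ev: "eigenvector A z k"
    using spectral_radius_mem_max(1)[OF A n] by (auto simp: spectrum_def eigenvalue_def)
  obtain i c where i: "i < n" "0 < c" "cmod (z $ i) = c * x i"
    and c: "\<And>t. t < n \<Longrightarrow> cmod (z $ t) \<le> c * x t"
    and row: "\<And>t. t < n \<Longrightarrow> cmod k * cmod (z $ t) \<le> (\<Sum>s<n. cmod (A $$ (t, s)) * cmod (z $ s))"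
    by (rule eigenvector_extremal_row[where x = x and n = n, OF A x ev]) blast+
  have mono: "(\<Sum>s<n. cmod (A $$ (t, s)) * cmod (z $ s)) \<le> (\<Sum>s<n. cmod (A $$ (t, s)) * (c * x s))"
    for t using c by (intro sum_mono mult_left_mono) auto
  have scale: "(\<Sum>s<n. cmod (A $$ (t, s)) * (c * x s)) = c * (\<Sum>s<n. cmod (A $$ (t, s)) * x s)" for t
    by (simp add: sum_distrib_left mult_ac)
  have bound: "c * (\<Sum>s<n. cmod (A $$ (t, s)) * x s) \<le> B * (c * x t)" if "t < n" for t
    using mult_left_mono[OF B[OF that], of c] i(2) by (simp add: mult_ac)
  have "cmod k * (c * x i) \<le> B * (c * x i)"
    using row[OF i(1)] mono[of i] bound[OF i(1)] unfolding scale i(3) by linarith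
  moreover have "0 < c * x i" using i x by simp
  ultimately show "spectral_radius A \<le> B" unfolding k by (rule mult_right_le_imp_le)
  assume eq: "spectral_radius A = B" and r: "r < n"
    and nz: "\<And>r t. r < n \<Longrightarrow> t < n \<Longrightarrow> r \<noteq> t \<Longrightarrow> A $$ (r, t) \<noteq> 0"
  \<comment> \<open>For \<open>cmod k = B\<close> the chain of inequalities in row \<open>i\<close>
    collapses, so its nonnegative slacks must all vanish.\<close>
  have "(\<Sum>s<n. cmod (A $$ (i, s)) * (c * x s - cmod (z $ s))) \<le> 0"
    using row[OF i(1)] bound[OF i(1)] eq unfolding scale[symmetric] i(3) k
    by (simp add: right_diff_distrib sum_subtractf)
  moreover have "0 \<le> cmod (A $$ (i, s)) * (c * x s - cmod (z $ s))" if "s \<in> {..<n}" for s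
    using c that by simp
  ultimately have "\<forall>s\<in>{..<n}. cmod (A $$ (i, s)) * (c * x s - cmod (z $ s)) = 0"
    by (meson antisym finite_lessThan sum_nonneg sum_nonneg_eq_0_iff)
  \<comment> \<open>The diagonal entry may be zero, but at \<open>s = i\<close> the equality holds
    by the choice of \<open>i\<close>.\<close>
  then have z: "cmod (z $ s) = c * x s" if "s < n" for s
    using that nz[OF i(1) that] i(3) by (cases "s = i") auto
  have "B * (c * x r) \<le> c * (\<Sum>s<n. cmod (A $$ (r, s)) * x s)"
    using row[OF r] mono[of r] unfolding scale z[OF r] k[symmetric] eq by linarith
  with bound[OF r] have "c * (\<Sum>s<n. cmod (A $$ (r, s)) * x s) = B * (c * x r)"
    by (rule antisym)
  also have "\<dots> = c * (B * x r)" by (rule mult.left_commute)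
  finally have "c * (\<Sum>s<n. cmod (A $$ (r, s)) * x s) = c * (B * x r)" .
  with i(2) show "(\<Sum>t<n. cmod (A $$ (r, t)) * x t) = B * x r" by simp
qed

section \<open>Equality case: the square roots of the row sums form an eigenvector\<close>

lemma row_sums_constant_if_sqrt_eigenvector:
  fixes w :: "nat \<Rightarrow> nat \<Rightarrow> real" and n :: nat
  defines "d \<equiv> \<lambda>r. \<Sum>t<n. w r t"
  assumes sym: "\<And>r t. r < n \<Longrightarrow> t < n \<Longrightarrow> w r t = w t r"
    and diag: "\<And>r. r < n \<Longrightarrow> w r r = 0"
    and pos: "\<And>r t. r < n \<Longrightarrow> t < n \<Longrightarrow> r \<noteq> t \<Longrightarrow> 0 < w r t"
    and ev: "\<And>r. r < n \<Longrightarrow> (\<Sum>t<n. w r t * sqrt (d t)) = B * sqrt (d r)"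
    and "r < n" "t < n"
  shows "d r = d t"
proof (rule ccontr)
  assume ne: "d r \<noteq> d t"
  have nonneg: "0 \<le> w i j" if "i < n" "j < n" for i j
    using pos[OF that] diag[OF that(1)] by (cases "i = j") auto
  have "finite (d ` {..<n})" "d ` {..<n} \<noteq> {}" using \<open>r < n\<close> by auto
  then have "Min (d ` {..<n}) \<in> d ` {..<n}" "Max (d ` {..<n}) \<in> d ` {..<n}"
    by (auto intro: Min_in Max_in)
  then obtain p q where p: "p < n" "d p = Min (d ` {..<n})" and q: "q < n" "d q = Max (d ` {..<n})"
    by auto
  have mn: "d p \<le> d i" and mx: "d i \<le> d q" if "i < n" for i
    using that by (auto simp: p(2) q(2))
  have "d p < d q"
    using ne mn[OF \<open>r < n\<close>] mn[OF \<open>t < n\<close>] mx[OF \<open>r < n\<close>] mx[OF \<open>t < n\<close>] by linarith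
  then have "p \<noteq> q" by auto
  have "w p q \<le> d p"
    unfolding d_def using p(1) q(1) nonneg by (intro member_le_sum) auto
  with pos[OF p(1) q(1) \<open>p \<noteq> q\<close>] have "0 < d p" by linarith
  define a b where "a = sqrt (d p)" and "b = sqrt (d q)"
  have ab: "0 < a" "0 < b" "d p = a * a" "d q = b * b"
    using \<open>0 < d p\<close> \<open>d p < d q\<close> by (auto simp: a_def b_def)
  \<comment> \<open>Row \<open>p\<close> is compared with the upper bound \<open>b\<close> for the
    eigenvector, which will give \<open>B \<le> a * b\<close>; below, row \<open>q\<close> is
    compared with the lower bound \<open>a\<close>, for the converse.\<close>
  have "(\<Sum>i<n. w p i * (b - sqrt (d i))) = b * d p - B * a"
    using ev[OF p(1)] by (simp add: right_diff_distrib sum_subtractf a_def d_def mult.commute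
        sum_distrib_left)
  then have sp: "(\<Sum>i<n. w p i * (b - sqrt (d i))) = a * (a * b - B)"
    by (simp add: ab algebra_simps)
  have "(\<Sum>i<n. w q i * (sqrt (d i) - a)) = B * b - a * d q"
    using ev[OF q(1)] by (simp add: right_diff_distrib sum_subtractf b_def d_def mult.commute
        sum_distrib_left)
  then have sq: "(\<Sum>i<n. w q i * (sqrt (d i) - a)) = b * (B - a * b)"
    by (simp add: ab algebra_simps)
  have np: "0 \<le> w p i * (b - sqrt (d i))" if "i \<in> {..<n}" for i
    using that nonneg[OF p(1)] mx by (simp add: b_def)
  have nq: "0 \<le> w q i * (sqrt (d i) - a)" if "i \<in> {..<n}" for i
    using that nonneg[OF q(1)] mn by (simp add: a_def)
  have "0 \<le> a * (a * b - B)" "0 \<le> b * (B - a * b)"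
    unfolding sp[symmetric] sq[symmetric] using np nq by (auto intro: sum_nonneg)
  with ab(1,2) have "B = a * b" by (simp add: zero_le_mult_iff)
  have "\<forall>i\<in>{..<n}. w p i * (b - sqrt (d i)) = 0"
    using sum_nonneg_eq_0_iff[OF finite_lessThan np] sp \<open>B = a * b\<close> by simp
  moreover have "\<forall>i\<in>{..<n}. w q i * (sqrt (d i) - a) = 0"
    using sum_nonneg_eq_0_iff[OF finite_lessThan nq] sq \<open>B = a * b\<close> by simp
  moreover have "a < b" using \<open>d p < d q\<close> by (simp add: a_def b_def)
  \<comment> \<open>A third index would have positive weight in both rows, forcing
    \<open>sqrt (d i)\<close> to equal both \<open>b\<close> and \<open>a\<close>.\<close>
  ultimately have "i = p \<or> i = q" if "i < n" for i
    using that pos[OF p(1) that] pos[OF q(1) that]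
    by (metis eq_iff_diff_eq_0 lessThan_iff less_irrefl mult_eq_0_iff)
  then have "{..<n} = {p, q}" using p(1) q(1) by auto
  then have "d p = w p q" "d q = w q p"
    using \<open>p \<noteq> q\<close> p(1) q(1) diag by (simp_all add: d_def)
  with sym[OF p(1) q(1)] \<open>d p < d q\<close> show False by simp
qed

text \<open>The all-ones vector is an eigenvector for the eigenvalue \<open>c\<close>.\<close>

lemma le_spectral_radius_if_constant_row_sums:
  fixes A :: "complex mat"
  assumes A: "A \<in> carrier_mat n n" and n: "0 < n"
    and sums: "\<And>r. r < n \<Longrightarrow> (\<Sum>t<n. A $$ (r, t)) = c"
  shows "cmod c \<le> spectral_radius A"
proof -
  let ?z = "vec n (\<lambda>_. 1) :: complex vec"
  have "?z $ 0 \<noteq> 0\<^sub>v n $ 0" using n by simp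
  then have "?z \<noteq> 0\<^sub>v n" by metis
  moreover have "A *\<^sub>v ?z = c \<cdot>\<^sub>v ?z"
    using A sums by (intro eq_vecI) (auto simp: scalar_prod_def lessThan_atLeast0)
  ultimately have "eigenvector A ?z c" using A by (simp add: eigenvector_def)
  then have "c \<in> spectrum A" by (auto simp: spectrum_def eigenvalue_def)
  then show ?thesis using spectral_radius_mem_max(2)[OF A n] by blast
qed

section \<open>Application to the distance Seidel matrix\<close>

theorem theorem4p1:
  fixes G :: "('a, 'b) pre_digraph" and v :: "nat \<Rightarrow> 'a" and n :: nat
  assumes "Digraph.graph G"
    and "Digraph_Component.connected G"
    and "n \<ge> 2"
    and "bij_betw v {0..<n} (verts G)"
  shows "dist_seidel_radius G v n \<le> dist_seidel_bound G v n \<and>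
    (dist_seidel_radius G v n = dist_seidel_bound G v n \<longleftrightarrow>
       (\<forall>r<n. \<forall>t<n. dist_seidel_sum G v n r = dist_seidel_sum G v n t))"
proof -
  \<comment> \<open>These are the entries of the negated distance Seidel matrix. The diagonal is set
    to 0 separately, since \<open>2 * 0 - 1\<close> would give -1; sums omitting \<open>r\<close>
    can thus run over all indices.\<close>
  define w where "w r t = (if r = t then 0 else 2 * gdist G (v r) (v t) - 1)" for r t
  define d where "d = (\<lambda>r. \<Sum>t<n. w r t)"
  define A where "A = map_mat complex_of_real (dist_seidel_mat G v n)"
  define B where "B = dist_seidel_bound G v n"
  have verts: "v r \<in> verts G" if "r < n" for r
    using assms(4) that by (auto simp: bij_betw_def)
  have w_pos: "0 < w r t" if "r < n" "t < n" "r \<noteq> t" for r t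
  proof -
    have "v r \<noteq> v t" using assms(4) that by (auto simp: bij_betw_def inj_on_def)
    with gdist_ge_1[OF assms(1,2) verts verts] that show ?thesis by (fastforce simp: w_def)
  qed
  have w_nonneg: "0 \<le> w r t" if "r < n" "t < n" for r t
    using w_pos[OF that] by (cases "r = t") (auto simp: w_def)
  have w_sym: "w r t = w t r" for r t
    by (simp add: w_def gdist_commute[OF assms(1)])
  have off_diag: "(\<Sum>t\<in>{0..<n} - {r}. (2 * gdist G (v r) (v t) - 1) * f t) = (\<Sum>t<n. w r t * f t)"
    for r f
    by (rule sum.mono_neutral_cong_left) (auto simp: w_def)
  have d: "dist_seidel_sum G v n r = d r" for r
    using off_diag[where f = "\<lambda>_. 1"] by (simp add: dist_seidel_sum_def d_def)
  have d_pos: "0 < d r" if "r < n" for r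
  proof -
    define t where "t = (if r = 0 then 1 else 0 :: nat)"
    have t: "t < n" "r \<noteq> t" using assms(3) by (auto simp: t_def)
    have "w r t \<le> d r" unfolding d_def using w_nonneg that t by (intro member_le_sum) auto
    with w_pos[OF that t] show ?thesis by linarith
  qed
  have A: "A \<in> carrier_mat n n"
    by (auto simp: A_def dist_seidel_mat_def all_ones_mat_def dist_mat_def)
  have A_entry: "A $$ (r, t) = - complex_of_real (w r t)" if "r < n" "t < n" for r t
    using that gdist_self[OF assms(1) verts]
    by (auto simp: A_def dist_seidel_mat_def all_ones_mat_def dist_mat_def w_def)
  have A_norm: "(\<Sum>t<n. cmod (A $$ (r, t)) * f t) = (\<Sum>t<n. w r t * f t)" if "r < n" for r f
    using that w_nonneg by (intro sum.cong) (auto simp: A_entry)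
  \<comment> \<open>Splitting the square root of the quotient exhibits \<open>B\<close> as the
    largest Collatz--Wielandt quotient at the vector \<open>sqrt (d r)\<close>.\<close>
  have B: "B = (MAX r\<in>{0..<n}. (\<Sum>t<n. w r t * sqrt (d t)) / sqrt (d r))"
    unfolding B_def dist_seidel_bound_def off_diag d
    by (simp add: real_sqrt_divide sum_divide_distrib)
  have le: "(\<Sum>t<n. w r t * sqrt (d t)) \<le> B * sqrt (d r)" if "r < n" for r
  proof -
    have "(\<Sum>t<n. w r t * sqrt (d t)) / sqrt (d r) \<le> B"
      unfolding B using that by (intro Max_ge) auto
    then show ?thesis using d_pos[OF that] by (simp add: pos_divide_le_eq)
  qed
  have n: "0 < n" using assms(3) by simp
  have bound: "(\<Sum>t<n. cmod (A $$ (r, t)) * sqrt (d t)) \<le> B * sqrt (d r)" if "r < n" for r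
    using le that by (simp add: A_norm)
  have sqrt_pos: "0 < sqrt (d r)" if "r < n" for r using d_pos that by simp
  note cw = spectral_radius_le_weighted_row_sums[where x = "\<lambda>r. sqrt (d r)", OF A n sqrt_pos bound]
  have "d r = d t" if eq: "spectral_radius A = B" and rt: "r < n" "t < n" for r t
  proof -
    have nz: "A $$ (i, j) \<noteq> 0" if "i < n" "j < n" "i \<noteq> j" for i j
      using w_pos[OF that] that by (simp add: A_entry)
    have ev: "(\<Sum>j<n. w i j * sqrt (d j)) = B * sqrt (d i)" if "i < n" for i
      using cw(2)[OF _ _ eq nz] that by (simp add: A_norm)
    show ?thesis
      unfolding d_def using w_sym w_pos ev rt
      by (intro row_sums_constant_if_sqrt_eigenvector[where B = B]) (auto simp: w_def d_def)
  qed
  moreover have "spectral_radius A = B" if eq: "\<forall>r<n. \<forall>t<n. d r = d t"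
  proof -
    have const: "d r = d 0" if "r < n" for r using eq n that by blast
    have "(\<Sum>t<n. w r t * sqrt (d t)) / sqrt (d r) = d 0" if "r < n" for r
    proof -
      have "(\<Sum>t<n. w r t * sqrt (d t)) = (\<Sum>t<n. w r t * sqrt (d r))"
      proof (rule sum.cong[OF refl])
        fix t assume "t \<in> {..<n}"
        then have "d t = d r" using eq that by blast
        then show "w r t * sqrt (d t) = w r t * sqrt (d r)" by (rule arg_cong)
      qed
      also have "\<dots> = d r * sqrt (d r)" by (simp add: d_def sum_distrib_right)
      finally have "(\<Sum>t<n. w r t * sqrt (d t)) / sqrt (d r) = d r" using d_pos[OF that] by simp
      then show ?thesis using const[OF that] by linarith
    qed
    then have "B = d 0" unfolding B using n by (simp add: image_constant_conv cong: image_cong_simp)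
    \<comment> \<open>The sign is that of \<open>A\<close>, whose off-diagonal entries are negative;
      the modulus \<open>d 0\<close> of this eigenvalue bounds the spectral radius from
      below.\<close>
    have "(\<Sum>t<n. A $$ (r, t)) = complex_of_real (- d 0)" if "r < n" for r
      using that const[OF that, symmetric] by (simp add: A_entry d_def sum_negf)
    from le_spectral_radius_if_constant_row_sums[OF A n this] d_pos[OF n]
    have "d 0 \<le> spectral_radius A" by simp
    with cw(1) \<open>B = d 0\<close> show ?thesis by simp
  qed
  ultimately show ?thesis
    using cw(1) unfolding dist_seidel_radius_def A_def[symmetric] B_def[symmetric] d by blast
qed

end
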